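(* For every positive integer $H$, $$ \mathcal{G}(H)\leq \left(2+\frac{8}{\pi}\right) \log H+O(1),$$ with an absolute implied constant, where $$\mathcal{G}(H)=\max_{\alpha\in [0, 1)} \max_{(y_{-H}, \dots, y_{-1}, y_1,\dots, y_{H})\in [-2, 2]^{2H}} \left|\sum_{1\leq |h|\leq H} \frac{e(\alpha h)-1}{h}\, y_h\right|.$$
   Context: $e(z)=\exp(2\pi i z)$; $h$ ranges over nonzero integers with $|h|\le H$. *)

theory Defs
  imports "HOL-Analysis.Analysis"
begin

definition e :: "real \<Rightarrow> complex" where
  "e z = exp (2 * of_real pi * \<i> * of_real z)"

definition freqs :: "nat \<Rightarrow> int set" where
  "freqs H = {h. 1 \<le> \<bar>h\<bar> \<and> \<bar>h\<bar> \<le> int H}"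

text \<open>The cube of real vectors of length \<open>2H\<close>, indexed by the nonzero integers
  of absolute value at most \<open>H\<close>.\<close>

definition cube :: "nat \<Rightarrow> (int \<Rightarrow> real) set" where
  "cube H = freqs H \<rightarrow>\<^sub>E {-2..2}"

definition osc_sum :: "nat \<Rightarrow> real \<Rightarrow> (int \<Rightarrow> real) \<Rightarrow> real" where
  "osc_sum H \<alpha> y =
     cmod (\<Sum>h\<in>freqs H. (e (\<alpha> * of_int h) - 1) / of_int h * of_real (y h))"

text \<open>The maxima are written as suprema; \<open>calG_is_max\<close> below shows that they
  are attained, so that the value is the genuine maximum.\<close>

definition calG :: "nat \<Rightarrow> real" where
  "calG H = (SUP \<alpha>\<in>{0..<1}. SUP y\<in>cube H. osc_sum H \<alpha> y)"

lemma finite_freqs [simp]: "finite (freqs H)"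
proof -
  have "freqs H \<subseteq> {-int H..int H}" by (auto simp: freqs_def)
  then show ?thesis by (rule finite_subset) simp
qed

lemma compact_cube: "compact (cube H)"
proof -
  have "cube H = PiE UNIV (\<lambda>i. if i \<in> freqs H then {-2..2} else {undefined})"
    by (auto simp: cube_def PiE_def Pi_def extensional_def split: if_splits)
  moreover have "compactin (product_topology (\<lambda>i::int. euclidean) UNIV)
     (PiE UNIV (\<lambda>i. if i \<in> freqs H then {-2..2::real} else {undefined}))"
    by (subst compactin_PiE) auto
  ultimately show ?thesis
    by (simp add: euclidean_product_topology)
qed

lemma cube_nonempty: "cube H \<noteq> {}"
  by (auto simp: cube_def PiE_eq_empty_iff)

lemma continuous_osc_sum: "continuous_on S (\<lambda>p. osc_sum H (fst p) (snd p))"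
proof -
  have "continuous_on S (\<lambda>p::real \<times> (int \<Rightarrow> real). snd p h)" for h
    by (rule continuous_on_product_then_coordinatewise) (intro continuous_intros)
  then show ?thesis
    unfolding osc_sum_def e_def divide_inverse by (intro continuous_intros) auto
qed

lemma osc_sum_max:
  obtains \<alpha> y where "\<alpha> \<in> {0..<1}" "y \<in> cube H"
    "\<And>\<beta> z. \<beta> \<in> {0..<1} \<Longrightarrow> z \<in> cube H \<Longrightarrow> osc_sum H \<beta> z \<le> osc_sum H \<alpha> y"
proof -
  have "compact ({0..1::real} \<times> cube H)"
    by (intro compact_Times compact_cube) simp
  moreover have "{0..1::real} \<times> cube H \<noteq> {}" using cube_nonempty by auto
  ultimately obtain p where p: "p \<in> {0..1} \<times> cube H"
    and mx: "\<forall>q\<in>{0..1} \<times> cube H. osc_sum H (fst q) (snd q) \<le> osc_sum H (fst p) (snd p)"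
    using continuous_attains_sup[OF _ _ continuous_osc_sum] by meson
  obtain a y where ay: "p = (a, y)" by (cases p)
  define b where "b = (if a = 1 then 0 else a)"
  have "e (1 * of_int h) = 1" for h
    by (simp add: e_def exp_eq_1 mult.commute)
  then have "osc_sum H 1 y = osc_sum H 0 y" by (simp add: osc_sum_def e_def)
  then have "osc_sum H b y = osc_sum H a y" by (simp add: b_def)
  moreover have "b \<in> {0..<1}" using p ay by (auto simp: b_def)
  ultimately show ?thesis using p mx ay by (intro that[of b y]) auto
qed

lemma calG_is_max:
  "\<exists>\<alpha>\<in>{0..<1}. \<exists>y\<in>cube H. calG H = osc_sum H \<alpha> y \<and>
     (\<forall>\<beta>\<in>{0..<1}. \<forall>z\<in>cube H. osc_sum H \<beta> z \<le> osc_sum H \<alpha> y)"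
proof -
  obtain a y where a: "a \<in> {0..<1}" and y: "y \<in> cube H"
    and mx: "\<And>\<beta> z. \<beta> \<in> {0..<1} \<Longrightarrow> z \<in> cube H \<Longrightarrow> osc_sum H \<beta> z \<le> osc_sum H a y"
    using osc_sum_max[of H] by blast
  have le: "(SUP z\<in>cube H. osc_sum H \<beta> z) \<le> osc_sum H a y" if "\<beta> \<in> {0..<1}" for \<beta>
    using mx[OF that] cube_nonempty by (intro cSUP_least) auto
  have "osc_sum H a y \<le> (SUP z\<in>cube H. osc_sum H a z)"
    using mx[OF a] y by (intro cSUP_upper bdd_aboveI2) auto
  also have "\<dots> \<le> calG H"
    unfolding calG_def using a le by (intro cSUP_upper bdd_aboveI2) auto
  finally have "osc_sum H a y \<le> calG H" .
  moreover have "calG H \<le> osc_sum H a y"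
    unfolding calG_def by (rule cSUP_least) (use le in auto)
  ultimately show ?thesis using a y mx by (metis order_antisym)
qed

end

theory Submission
  imports Defs
begin

text \<open>Write the modulus of the sum \<open>z\<close> as \<open>Re (w z)\<close> with a unit vector \<open>w = p + \<i> q\<close> and put
  \<open>\<theta> = 2\<pi>\<alpha>h\<close>. The frequencies \<open>h\<close> and \<open>-h\<close> together contribute at most
  \<open>(4/h) max (\<bar>p\<bar> (1 - cos \<theta>)) (\<bar>q\<bar> \<bar>sin \<theta>\<bar>)\<close>, and the Cauchy--Schwarz inequality bounds this
  maximum by \<open>1 - \<bar>p\<bar> cos \<theta>\<close>. The sums of \<open>cos (h\<theta>) / h\<close> are bounded below uniformly, so only
  the mean value \<open>1\<close> of this majorant meets the logarithm. The resulting leading constant \<open>4\<close>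
  is smaller than \<open>2 + 8/\<pi>\<close>.\<close>

lemma abs_sin_of_nat_mult_le: "\<bar>sin (of_nat n * x)\<bar> \<le> of_nat n * \<bar>sin x\<bar>" for x :: real
proof (induction n)
  case (Suc n)
  have "\<bar>sin (of_nat (Suc n) * x)\<bar> \<le> \<bar>sin (of_nat n * x) * cos x\<bar> + \<bar>cos (of_nat n * x) * sin x\<bar>"
    using abs_triangle_ineq[of "sin (of_nat n * x) * cos x" "cos (of_nat n * x) * sin x"]
    by (simp add: distrib_right sin_add algebra_simps)
  also have "\<dots> \<le> \<bar>sin (of_nat n * x)\<bar> * 1 + 1 * \<bar>sin x\<bar>"
    unfolding abs_mult by (intro add_mono mult_mono) auto
  finally show ?case using Suc by (simp add: distrib_right)
qed simp

text \<open>The sum is split near \<open>1 / \<bar>sin x\<bar>\<close>. Before that point the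
  cosines are close enough to 1 that the sum loses at most 2; after it, oscillation bounds the loss
  by 2 again. No upper bound is uniform, since the sum is harmonic at \<open>x = 0\<close>.\<close>

lemma sum_cos_over_ge:
  fixes x :: real
  shows "(\<Sum>k = 1..n. cos (of_nat k * (2 * x)) / of_nat k) \<ge> -4"
proof -
  define S where "S n x = (\<Sum>k = 1..n. cos (of_nat k * (2 * x)) / of_nat k)" for n and x :: real
  \<comment> \<open>\<open>cos (2kx) = 1 - 2 sin^2 (kx)\<close>, and a number in [0, 1] dominates
    its square, so the loss is linear in \<open>k\<close>; this cancels the weight
    \<open>1/k\<close>.\<close>
  have short: "S n x \<ge> -2 * \<bar>sin x\<bar> * of_nat n" if nx: "of_nat n * \<bar>sin x\<bar> \<le> 1" for n x
  proof -
    have "cos (of_nat k * (2 * x)) / of_nat k \<ge> -2 * \<bar>sin x\<bar>" if k: "k \<in> {1..n}" for k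
    proof -
      have "of_nat k * \<bar>sin x\<bar> \<le> of_nat n * \<bar>sin x\<bar>"
        using k by (intro mult_right_mono) auto
      then have 1: "of_nat k * \<bar>sin x\<bar> \<le> 1" using nx by linarith
      have "(sin (of_nat k * x))\<^sup>2 \<le> (of_nat k * \<bar>sin x\<bar>) ^ 2"
        using abs_sin_of_nat_mult_le[of k x] by (metis abs_ge_zero power2_abs power_mono)
      also have "\<dots> \<le> (of_nat k * \<bar>sin x\<bar>) * 1"
        unfolding power2_eq_square using 1 by (intro mult_left_mono) auto
      finally have "cos (of_nat k * (2 * x)) \<ge> 1 - 2 * (of_nat k * \<bar>sin x\<bar>)"
        using cos_double_sin[of "of_nat k * x"] by (simp add: algebra_simps)
      then show ?thesis using k by (simp add: field_simps)
    qed
    then have "(\<Sum>k = 1..n. -2 * \<bar>sin x\<bar>) \<le> S n x"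
      unfolding S_def by (intro sum_mono)
    then show ?thesis by (simp add: mult.commute)
  qed
  \<comment> \<open>Summation by parts for the telescoping terms \<open>2 sin x cos (2kx)\<close>, in a form closed under
    induction: the step only uses \<open>1 + sin \<ge> 0\<close>.\<close>
  have abel: "2 * sin x * (S n x - S m x) \<ge> (1 + sin ((2 * of_nat n + 1) * x)) / of_nat n - 2 / of_nat m"
    if "m \<ge> 1" "n \<ge> m" for n m x
    using \<open>n \<ge> m\<close>
  proof (induction n rule: dec_induct)
    case base
    then show ?case
      using \<open>m \<ge> 1\<close> sin_le_one[of "(2 * of_nat m + 1) * x"]
      by (simp add: divide_right_mono)
  next
    case (step n)
    define a where "a = sin ((2 * of_nat n + 1) * x)"
    define b where "b = sin ((2 * of_nat (Suc n) + 1) * x)"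
    have n: "real n > 0" using step \<open>m \<ge> 1\<close> by simp
    have "b - a = 2 * sin x * cos (of_nat (Suc n) * (2 * x))"
    proof -
      have "b = sin (of_nat (Suc n) * (2 * x) + x)" "a = sin (of_nat (Suc n) * (2 * x) - x)"
        by (simp_all add: a_def b_def algebra_simps)
      then show ?thesis by (simp only: sin_add sin_diff) simp
    qed
    then have "2 * sin x * (S (Suc n) x - S m x) = 2 * sin x * (S n x - S m x) + (b - a) / of_nat (Suc n)"
      by (simp add: S_def algebra_simps)
    moreover have "1 + a \<ge> 0"
      using sin_ge_minus_one[of "(2 * of_nat n + 1) * x"] unfolding a_def by linarith
    then have "(1 + a) / real n \<ge> (1 + a) / of_nat (Suc n)"
      using n by (intro divide_left_mono) auto
    ultimately show ?case
      using step.IH unfolding a_def[symmetric] b_def[symmetric]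
      by (simp add: add_divide_distrib diff_divide_distrib)
  qed
  have pos: "S n x \<ge> -4" if s: "sin x > 0" for n x
  proof -
    \<comment> \<open>This cut-off puts \<open>m * sin x\<close> between 1/2 and 1: small enough for
      \<open>short\<close> at \<open>m\<close>, large enough that the tail costs at most
      \<open>1 / (m * sin x) \<le> 2\<close>.\<close>
    define m where "m = nat \<lfloor>1 / sin x\<rfloor>"
    have "1 / sin x \<ge> 1" using s by simp
    then have m: "m \<ge> 1" "real m \<le> 1 / sin x" "1 / sin x < real m + 1"
      unfolding m_def by linarith+
    then have ms: "real m * sin x \<le> 1" "1 < real m * sin x + sin x"
      using s by (simp_all add: field_simps)
    have "1 * sin x \<le> real m * sin x" using s m by (intro mult_right_mono) auto
    then have half: "1 / 2 \<le> real m * sin x" using ms by linarith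
    show ?thesis
    proof (cases "n \<le> m")
      case True
      then have "real n * sin x \<le> real m * sin x" using s by (intro mult_right_mono) auto
      then have "real n * sin x \<le> 1" using ms by linarith
      then show ?thesis using short[of n x] s by (simp add: mult.commute)
    next
      case False
      have "1 + sin ((2 * of_nat n + 1) * x) \<ge> 0"
        using sin_ge_minus_one[of "(2 * of_nat n + 1) * x"] by linarith
      then have "(1 + sin ((2 * of_nat n + 1) * x)) / real n \<ge> 0"
        by (intro divide_nonneg_nonneg) auto
      then have "2 * sin x * (S n x - S m x) \<ge> - 2 / real m"
        using abel[of m n x] m False by simp
      then have "S n x - S m x \<ge> - (1 / (real m * sin x))"
        using s m by (simp add: field_simps)
      moreover have "1 / (real m * sin x) \<le> 2"
        using half by (simp add: field_simps)
      moreover have "S m x \<ge> -2" using short[of m x] ms s by (simp add: mult.commute)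
      ultimately show ?thesis by linarith
    qed
  qed
  \<comment> \<open>\<open>S\<close> is even in \<open>x\<close> and \<open>sin\<close> is odd,
    which settles negative sines. If \<open>sin x = 0\<close>, every \<open>n\<close> lies in the
    range of \<open>short\<close>.\<close>
  have "S n x \<ge> -4"
  proof (cases "sin x" "0::real" rule: linorder_cases)
    case less
    then show ?thesis using pos[of "-x" n] by (simp add: S_def)
  next
    case equal
    then show ?thesis using short[of n x] by simp
  qed (use pos in auto)
  then show ?thesis by (simp add: S_def)
qed

lemma sum_freqs:
  fixes f :: "int \<Rightarrow> 'a :: comm_monoid_add"
  shows "sum f (freqs H) = (\<Sum>k = 1..H. f (int k) + f (- int k))"
proof -
  have "freqs H = int ` {1..H} \<union> (\<lambda>k. - int k) ` {1..H}"
  proof (intro equalityI subsetI)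
    fix h assume "h \<in> freqs H"
    then show "h \<in> int ` {1..H} \<union> (\<lambda>k. - int k) ` {1..H}"
      by (cases h rule: int_cases2) (auto simp: freqs_def)
  qed (auto simp: freqs_def)
  moreover have "int ` {1..H} \<inter> (\<lambda>k. - int k) ` {1..H} = {}" by auto
  ultimately show ?thesis
    by (simp add: sum.union_disjoint sum.reindex inj_on_def sum.distrib)
qed

lemma Re_freq_term_le:
  assumes "norm w \<le> 1" "\<bar>y\<bar> \<le> 2" "\<bar>y'\<bar> \<le> 2" "k > 0"
  shows "Re (w * ((e (\<alpha> * of_int (int k)) - 1) / of_int (int k) * of_real y)) +
         Re (w * ((e (\<alpha> * of_int (- int k)) - 1) / of_int (- int k) * of_real y'))
         \<le> 4 * (1 - \<bar>Re w\<bar> * cos (of_nat k * (2 * (pi * \<alpha>)))) / of_nat k" (is "?L \<le> _")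
proof -
  define t where "t = of_nat k * (2 * (pi * \<alpha>))"
  define a where "a = Re w * (1 - cos t)"
  define b where "b = Im w * sin t"
  define M where "M = 1 - \<bar>Re w\<bar> * cos t"
  have e: "e (\<alpha> * of_int (int k)) = cis t" "e (\<alpha> * of_int (- int k)) = cis (- t)"
    by (simp_all add: e_def cis_conv_exp t_def algebra_simps)
  have w: "(Re w)\<^sup>2 + (Im w)\<^sup>2 \<le> 1"
    using assms(1) by (simp add: cmod_def)
  have "\<bar>Re w\<bar> \<le> 1" using abs_Re_le_cmod[of w] assms(1) by linarith
  moreover have "\<bar>a\<bar> = \<bar>Re w\<bar> * (1 - cos t)" by (simp add: a_def abs_mult)
  \<comment> \<open>After cancelling \<open>\<bar>Re w\<bar> * cos t\<close>, this is just
    \<open>\<bar>Re w\<bar> \<le> 1\<close>.\<close>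
  ultimately have aM: "\<bar>a\<bar> \<le> M"
    by (simp add: M_def algebra_simps)
  have bM: "\<bar>b\<bar> \<le> M"
  proof -
    \<comment> \<open>Cauchy-Schwarz for \<open>(\<bar>Re w\<bar>, \<bar>Im w\<bar>)\<close> and
      \<open>(cos t, \<bar>sin t\<bar>)\<close>, both of norm at most 1.\<close>
    have "0 \<le> (\<bar>Re w\<bar> - cos t)\<^sup>2 + (\<bar>Im w\<bar> - \<bar>sin t\<bar>)\<^sup>2" by simp
    also have "\<dots> = ((Re w)\<^sup>2 + (Im w)\<^sup>2) + ((sin t)\<^sup>2 + (cos t)\<^sup>2)
        - 2 * (\<bar>Re w\<bar> * cos t + \<bar>Im w\<bar> * \<bar>sin t\<bar>)"
      by (simp only: power2_diff power2_abs) (simp add: algebra_simps)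
    finally have "\<bar>Re w\<bar> * cos t + \<bar>Im w\<bar> * \<bar>sin t\<bar> \<le> 1"
      using w by simp
    then show ?thesis by (simp add: b_def M_def abs_mult)
  qed
  have "?L = (y * (- a - b) + y' * (a - b)) / of_nat k"
    unfolding e using assms(4) by (simp add: a_def b_def Re_divide_of_real field_simps)
  also have "y * (- a - b) + y' * (a - b) \<le> 2 * \<bar>a + b\<bar> + 2 * \<bar>a - b\<bar>"
  proof (rule add_mono)
    have "y * (- a - b) \<le> \<bar>y\<bar> * \<bar>a + b\<bar>"
      by (metis abs_ge_self abs_minus_cancel abs_mult minus_add_distrib uminus_add_conv_diff add.commute)
    also have "\<dots> \<le> 2 * \<bar>a + b\<bar>" using assms by (intro mult_right_mono) auto
    finally show "y * (- a - b) \<le> 2 * \<bar>a + b\<bar>" .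
    have "y' * (a - b) \<le> \<bar>y'\<bar> * \<bar>a - b\<bar>" by (metis abs_ge_self abs_mult)
    also have "\<dots> \<le> 2 * \<bar>a - b\<bar>" using assms by (intro mult_right_mono) auto
    finally show "y' * (a - b) \<le> 2 * \<bar>a - b\<bar>" .
  qed
  \<comment> \<open>\<open>\<bar>a + b\<bar> + \<bar>a - b\<bar>\<close> is twice the larger of
    \<open>\<bar>a\<bar>\<close> and \<open>\<bar>b\<bar>\<close>.\<close>
  also have "\<dots> \<le> 4 * M" using aM bM by (simp add: abs_if split: if_splits)
  finally show ?thesis
    using assms(4) by (simp add: M_def t_def divide_right_mono)
qed

lemma osc_sum_le:
  assumes "H \<ge> 1" "y \<in> cube H"
  shows "osc_sum H \<alpha> y \<le> 4 * ln (real H) + 20"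
proof -
  define z where "z = (\<Sum>h\<in>freqs H. (e (\<alpha> * of_int h) - 1) / of_int h * of_real (y h))"
  \<comment> \<open>This rotates \<open>z\<close> onto the nonnegative real axis. For
    \<open>z = 0\<close> it gives \<open>w = 0\<close>, so only \<open>norm w \<le> 1\<close> is
    available.\<close>
  define w where "w = cnj (sgn z)"
  have w: "norm w \<le> 1" by (simp add: w_def norm_sgn)
  have "of_real (cmod z) = w * z"
    using complex_norm_square[of z]
    by (cases "z = 0") (auto simp: w_def sgn_eq power2_eq_square field_simps)
  then have "osc_sum H \<alpha> y = Re (w * z)"
    unfolding osc_sum_def z_def[symmetric] by (metis Re_complex_of_real)
  also have "\<dots> = (\<Sum>h\<in>freqs H. Re (w * ((e (\<alpha> * of_int h) - 1) / of_int h * of_real (y h))))"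
    by (simp only: z_def sum_distrib_left Re_sum)
  also have "\<dots> \<le> (\<Sum>k = 1..H. 4 * (1 - \<bar>Re w\<bar> * cos (of_nat k * (2 * (pi * \<alpha>)))) / of_nat k)"
    unfolding sum_freqs
  proof (intro sum_mono Re_freq_term_le w)
    fix k assume k: "k \<in> {1..H}"
    then have "int k \<in> freqs H" "- int k \<in> freqs H" by (auto simp: freqs_def)
    then have "y (int k) \<in> {-2..2}" "y (- int k) \<in> {-2..2}"
      using assms(2) unfolding cube_def by (blast dest: PiE_mem)+
    then show "\<bar>y (int k)\<bar> \<le> 2" "\<bar>y (- int k)\<bar> \<le> 2" by auto
  qed auto
  also have "\<dots> = 4 * harm H - 4 * \<bar>Re w\<bar> * (\<Sum>k = 1..H. cos (of_nat k * (2 * (pi * \<alpha>))) / of_nat k)"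
    by (simp add: harm_def sum_distrib_left sum_subtractf[symmetric] field_simps)
  also have "\<dots> \<le> 4 * (ln (real H) + 1) + 16"
  proof -
    let ?S = "\<Sum>k = 1..H. cos (of_nat k * (2 * (pi * \<alpha>))) / of_nat k"
    have "\<bar>Re w\<bar> * (- ?S) \<le> \<bar>Re w\<bar> * 4"
      using sum_cos_over_ge[where n = H and x = "pi * \<alpha>"] by (intro mult_left_mono) auto
    moreover have "\<bar>Re w\<bar> \<le> 1" using abs_Re_le_cmod[of w] w by linarith
    \<comment> \<open>\<open>harm n - ln n\<close> is decreasing and equals 1 at
      \<open>n = 1\<close>.\<close>
    moreover have "harm H \<le> ln (real H) + 1"
      using euler_mascheroni_sequence_decreasing[of 1 H] assms(1) by (simp add: harm_def)
    ultimately show ?thesis by simp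
  qed
  finally show ?thesis by simp
qed

theorem theorem2p2:
  shows "\<exists>C::real. \<forall>H::nat. H \<ge> 1 \<longrightarrow> calG H \<le> (2 + 8 / pi) * ln (real H) + C"
proof (intro exI allI impI)
  fix H :: nat assume H: "H \<ge> 1"
  obtain \<alpha> y where "y \<in> cube H" "calG H = osc_sum H \<alpha> y"
    using calG_is_max by blast
  then have "calG H \<le> 4 * ln (real H) + 20" using osc_sum_le[OF H] by simp
  \<comment> \<open>\<open>4 \<le> 2 + 8 / pi\<close> amounts to \<open>pi \<le> 4\<close>, and
    \<open>ln H\<close> is nonnegative.\<close>
  moreover have "4 * ln (real H) \<le> (2 + 8 / pi) * ln (real H)"
    using H pi_less_4 by (intro mult_right_mono) (auto simp: field_simps)
  ultimately show "calG H \<le> (2 + 8 / pi) * ln (real H) + 20" by linarith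
qed

end
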